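(* Let $X$ be either $\ell_p=\ell_p(\mathbb{Z}_+)$ with $1\leq p<\infty$ or $X=c_0=c_0(\mathbb{Z}_+)$, and let $T:X\to X$ be a backward weighted shift with weight sequence $\{w_n\}_{n\in\mathbb{N}}$. Assume that $$\liminf_{n\to\infty}\Bigl(n!\prod_{j=1}^n|w_j|\Bigr)^{1/n}>0.$$ Then $I+T$ satisfies the Kitai Criterion.
   Context: Scalars are in $\mathbb{K}=\mathbb{R}$ or $\mathbb{C}$. A backward weighted shift on $\ell_p$ ($1\le p<\infty$) or $c_0$ with weight sequence $w=\{w_n\}_{n\in\mathbb{N}}$, a bounded sequence of non-zero numbers in $\mathbb{K}$, is the operator acting on the canonical basis $\{e_n\}_{n=0}^\infty$ by $Te_0=0$ and $Te_n=w_ne_{n-1}$ for $n\geq 1$. A bounded linear operator $T$ on a Banach space $X$ satisfies the Kitai Criterion if there exist dense subsets $E,F$ of $X$ and a map $S:F\to F$ such that $TSy=y$, $S^ky\to 0$ and $T^kx\to 0$ as $k\to\infty$ for all $y\in F$, $x\in E$. *)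

theory Defs
  imports "HOL-Analysis.Analysis" "HOL-Library.Function_Algebras"
begin

definition lp_space :: "real \<Rightarrow> (nat \<Rightarrow> 'a::real_normed_field) set" where
  "lp_space p = {x. summable (\<lambda>n. norm (x n) powr p)}"

definition lp_norm :: "real \<Rightarrow> (nat \<Rightarrow> 'a::real_normed_field) \<Rightarrow> real" where
  "lp_norm p x = (\<Sum>n. norm (x n) powr p) powr (1 / p)"

definition c0_space :: "(nat \<Rightarrow> 'a::real_normed_field) set" where
  "c0_space = {x. x \<longlonglongrightarrow> 0}"

definition c0_norm :: "(nat \<Rightarrow> 'a::real_normed_field) \<Rightarrow> real" where
  "c0_norm x = (SUP n. norm (x n))"

text \<open>Backward weighted shift: T e_0 = 0, T e_n = w_n e_(n-1),
  i.e. (T x)_m = w_(m+1) x_(m+1).\<close>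

definition bw_shift :: "(nat \<Rightarrow> 'a::real_normed_field) \<Rightarrow> (nat \<Rightarrow> 'a) \<Rightarrow> (nat \<Rightarrow> 'a)" where
  "bw_shift w x = (\<lambda>m. w (Suc m) * x (Suc m))"

definition dense_in :: "('b::minus \<Rightarrow> real) \<Rightarrow> 'b set \<Rightarrow> 'b set \<Rightarrow> bool" where
  "dense_in N X D \<longleftrightarrow> D \<subseteq> X \<and> (\<forall>x\<in>X. \<forall>e>0. \<exists>y\<in>D. N (x - y) < e)"

definition kitai_criterion :: "('b::ab_group_add \<Rightarrow> real) \<Rightarrow> 'b set \<Rightarrow> ('b \<Rightarrow> 'b) \<Rightarrow> bool" where
  "kitai_criterion N X T \<longleftrightarrow>
     (\<exists>E F S. dense_in N X E \<and> dense_in N X F \<and> S ` F \<subseteq> F \<and>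
        (\<forall>y\<in>F. T (S y) = y \<and> (\<lambda>k. N ((S ^^ k) y)) \<longlonglongrightarrow> 0) \<and>
        (\<forall>x\<in>E. (\<lambda>k. N ((T ^^ k) x)) \<longlonglongrightarrow> 0))"

end

theory Submission
  imports Defs
begin

text \<open>Put \<open>u\<^sub>n = e\<^sub>n / (w\<^sub>1 \<cdots> w\<^sub>n)\<close>. Then \<open>T u\<^sub>n = u\<^sub>n\<^sub>-\<^sub>1\<close>, and the growth condition says that
  \<open>\<parallel>u\<^sub>n\<parallel> \<le> K n! / d\<^sup>n\<close>. Let \<open>V\<close> be the Volterra operator. For a continuous function \<open>g\<close> and small
  \<open>b > 0\<close> the vector \<open>\<Sum>n. (V\<^sup>n g)(b) u\<^sub>n\<close> exists, because \<open>\<bar>V\<^sup>n g\<bar> \<le> sup \<bar>g\<bar> \<sqdot> b\<^sup>n / n!\<close> on \<open>[0, b]\<close>, and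
  \<open>T\<close> acts on it as \<open>V\<close> acts on \<open>g\<close>; with \<open>-V\<close> in place of \<open>V\<close> the same holds. So it suffices that
  \<open>(I - V)\<^sup>k V 1\<close> and \<open>(I + V)\<^sup>-\<^sup>k V 1\<close> tend to \<open>0\<close> uniformly on \<open>[0, 1/2]\<close>. Up to a factor \<open>e^{-x}\<close> in
  the second case, these are differences \<open>L\<^sub>k - L\<^sub>k\<^sub>+\<^sub>1 = - x L\<^sub>k\<^sub>+\<^sub>1' / (k + 1)\<close> of Laguerre polynomials,
  and an energy estimate for the Laguerre equation bounds them by \<open>1 / sqrt (k + 1)\<close>. The vectors
  obtained from \<open>g = V 1\<close> for varying \<open>b\<close> span a dense subspace.\<close>

section \<open>Laguerre polynomials and their iterated primitives\<close>

text \<open>The \<open>n\<close>-fold primitive, vanishing at \<open>0\<close>, of the \<open>k\<close>-th Laguerre polynomial.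
  In terms of \<open>V\<close> it is \<open>V\<^sup>n (I - V)\<^sup>k 1\<close>.\<close>

definition lag :: "nat \<Rightarrow> nat \<Rightarrow> real \<Rightarrow> real" where
  "lag k n x = (\<Sum>j\<le>k. (-1)^j * real (k choose j) * x^(n+j) / fact (n+j))"

lemma lag_0: "lag 0 n x = x^n / fact n"
  by (simp add: lag_def)

text \<open>Pascal's rule, read as one more application of \<open>I - V\<close>. This recurrence
  drives the forward orbits in \<open>forward_null_dense\<close>.\<close>

lemma lag_Suc: "lag (Suc k) n x = lag k n x - lag k (Suc n) x"
proof -
  have "lag (Suc k) n x = x^n / fact n
      + (\<Sum>j\<le>k. - ((-1)^j * real (Suc k choose Suc j) * x^(n + Suc j) / fact (n + Suc j)))"
    unfolding lag_def by (subst sum.atMost_Suc_shift) simp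
  also have "(\<Sum>j\<le>k. - ((-1)^j * real (Suc k choose Suc j) * x^(n + Suc j) / fact (n + Suc j)))
     = (\<Sum>j\<le>k. (-1)^Suc j * real (k choose Suc j) * x^(n + Suc j) / fact (n + Suc j))
       - lag k (Suc n) x"
    unfolding lag_def sum_subtractf [symmetric]
    by (intro sum.cong refl) (simp add: add_divide_distrib diff_divide_distrib ring_distribs del: fact_Suc)
  also have "x^n / fact n
      + ((\<Sum>j\<le>k. (-1)^Suc j * real (k choose Suc j) * x^(n + Suc j) / fact (n + Suc j)) - lag k (Suc n) x)
      = (\<Sum>j\<le>Suc k. (-1)^j * real (k choose j) * x^(n+j) / fact (n+j)) - lag k (Suc n) x"
    by (subst sum.atMost_Suc_shift) simp
  also have "\<dots> = lag k n x - lag k (Suc n) x"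
    by (simp add: lag_def binomial_eq_0)
  finally show ?thesis .
qed

lemma lag_at_0: "lag k n 0 = (if n = 0 then 1 else 0)"
  by (induction k arbitrary: n) (auto simp: lag_0 lag_Suc)

lemma has_derivative_power_fact:
  "((\<lambda>x::real. x^Suc n / fact (Suc n)) has_real_derivative x^n / fact n) (at x)"
  by (rule derivative_eq_intros refl | simp)+

lemma lag_deriv: "(lag k (Suc n) has_real_derivative lag k n x) (at x)"
proof (induction k arbitrary: n)
  case 0
  show ?case using has_derivative_power_fact [of n x] by (simp add: lag_0 [abs_def] del: fact_Suc power_Suc)
next
  case (Suc k)
  show ?case unfolding lag_Suc [abs_def]
    by (intro DERIV_diff Suc)
qed

text \<open>The derivative of the Laguerre polynomial of index \<open>k + 1\<close>, not \<open>k\<close>.\<close>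

definition lag_diff :: "nat \<Rightarrow> real \<Rightarrow> real" where
  "lag_diff k x = (\<Sum>j\<le>k. - ((-1)^j * real (Suc k choose Suc j) * x^j / fact j))"

lemma lag_deriv_0: "(lag (Suc k) 0 has_real_derivative lag_diff k x) (at x)"
proof -
  have eq: "lag (Suc k) 0 = (\<lambda>x. 1
      + (\<Sum>j\<le>k. - ((-1)^j * real (Suc k choose Suc j)) * (x^Suc j / fact (Suc j))))"
    unfolding lag_def by (rule ext, subst sum.atMost_Suc_shift) (simp del: fact_Suc)
  have "((\<lambda>x. 1 + (\<Sum>j\<le>k. - ((-1)^j * real (Suc k choose Suc j)) * (x^Suc j / fact (Suc j))))
      has_real_derivative 0 + (\<Sum>j\<le>k. - ((-1)^j * real (Suc k choose Suc j)) * (x^j / fact j))) (at x)"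
    by (intro DERIV_add DERIV_const DERIV_sum DERIV_cmult has_derivative_power_fact)
  then show ?thesis by (simp add: eq lag_diff_def)
qed

text \<open>The absorption identity for binomial coefficients, term by term. It turns control of
  \<open>x * y'\<close> for the Laguerre polynomial \<open>y\<close> of index \<open>k + 1\<close>
  into control of the primitive of the one of index \<open>k\<close>.\<close>

lemma lag_diff_identity: "x * lag_diff k x = - (real (Suc k) * lag k 1 x)"
proof -
  have "x * (- ((-1)^j * real (Suc k choose Suc j) * x^j / fact j))
     = - (real (Suc k) * ((-1)^j * real (k choose j) * x^(1+j) / fact (1+j)))" for j
  proof -
    have "real (Suc j) * real (Suc k choose Suc j) = real (Suc k) * real (k choose j)"
      using Suc_times_binomial [of j k] by (metis of_nat_mult)
    then have *: "real (Suc k choose Suc j) = real (Suc k) * real (k choose j) / real (Suc j)"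
      by (simp add: field_simps)
    show ?thesis unfolding * by (simp add: field_simps del: of_nat_Suc)
  qed
  then show ?thesis
    unfolding lag_def lag_diff_def sum_distrib_left sum_negf [symmetric]
    by (intro sum.cong refl) auto
qed

lemma lag_diff_differentiable: "\<exists>D. (lag_diff k has_real_derivative D) (at x)"
proof -
  have "((\<lambda>x. \<Sum>j\<le>k. - ((-1)^j * real (Suc k choose Suc j) / fact j) * x^j)
      has_real_derivative (\<Sum>j\<le>k. - ((-1)^j * real (Suc k choose Suc j) / fact j) * (real j * x^(j - 1)))) (at x)"
    by (intro DERIV_sum DERIV_cmult) (rule derivative_eq_intros refl | simp)+
  then show ?thesis by (auto simp: lag_diff_def [abs_def])
qed

lemma lag_1_bound:
  assumes x: "0 \<le> x" "x \<le> 1/2"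
  shows "\<bar>lag k 1 x\<bar> \<le> 1 / sqrt (Suc k)"
proof -
  \<comment> \<open>By the Laguerre equation \<open>x y'' + (1 - x) y' + m y = 0\<close> the energy \<open>m y\<^sup>2 + x y'\<^sup>2\<close>
    has derivative \<open>(2 x - 1) y'\<^sup>2\<close>, which is where the restriction to \<open>x \<le> 1/2\<close> comes from.\<close>
  define en where "en = (\<lambda>x. real (Suc k) * (lag (Suc k) 0 x)\<^sup>2 + x * (lag_diff k x)\<^sup>2)"
  have "en x \<le> en 0"
  proof (rule DERIV_nonpos_imp_nonincreasing [OF x(1)])
    fix t :: real assume t: "0 \<le> t" "t \<le> x"
    obtain D where D: "(lag_diff k has_real_derivative D) (at t)"
      using lag_diff_differentiable by blast
    \<comment> \<open>Differentiating both sides of \<open>lag_diff_identity\<close> yields the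
      Laguerre equation at \<open>t\<close> without computing the second derivative
      \<open>D\<close>.\<close>
    have "((\<lambda>x. x * lag_diff k x) has_real_derivative lag_diff k t + t * D) (at t)"
      by (rule derivative_eq_intros D refl | simp)+
    moreover have "((\<lambda>x. x * lag_diff k x) has_real_derivative - (real (Suc k) * lag k 0 t)) (at t)"
      unfolding lag_diff_identity using lag_deriv [of k 0 t]
      by (intro DERIV_minus DERIV_cmult) simp
    ultimately have "lag_diff k t + t * D = - (real (Suc k) * lag k 0 t)"
      by (rule DERIV_unique)
    moreover have "lag k 0 t = lag (Suc k) 0 t + lag k 1 t"
      using lag_Suc [of k 0 t] by simp
    ultimately have tD: "t * D = - lag_diff k t - real (Suc k) * lag (Suc k) 0 t + t * lag_diff k t"
      using lag_diff_identity [of t k] by (simp add: algebra_simps)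
    have "(en has_real_derivative 2 * real (Suc k) * lag (Suc k) 0 t * lag_diff k t
        + (lag_diff k t)\<^sup>2 + 2 * lag_diff k t * (t * D)) (at t)"
      unfolding en_def
      by (rule derivative_eq_intros D lag_deriv_0 refl | simp add: algebra_simps)+
    also have "2 * real (Suc k) * lag (Suc k) 0 t * lag_diff k t
        + (lag_diff k t)\<^sup>2 + 2 * lag_diff k t * (t * D) = (lag_diff k t)\<^sup>2 * (2 * t - 1)"
      unfolding tD by (simp add: algebra_simps power2_eq_square)
    finally have deriv: "(en has_real_derivative (lag_diff k t)\<^sup>2 * (2 * t - 1)) (at t)" .
    have "(lag_diff k t)\<^sup>2 * (2 * t - 1) \<le> 0"
      using t x by (intro mult_nonneg_nonpos) auto
    with deriv show "\<exists>y. (en has_real_derivative y) (at t) \<and> y \<le> 0"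
      by blast
  qed
  also have "en 0 = real (Suc k)" by (simp add: en_def lag_at_0)
  also have "en x = real (Suc k) * (lag (Suc k) 0 x)\<^sup>2 + x * (lag_diff k x)\<^sup>2" by (simp add: en_def)
  finally have "x * (lag_diff k x)\<^sup>2 \<le> real (Suc k)"
    by (rule order_trans [rotated]) simp
  \<comment> \<open>One more factor \<open>x <= 1\<close> produces the square of
    \<open>x * lag_diff k x\<close>, which \<open>lag_diff_identity\<close> evaluates.\<close>
  then have "x * (x * (lag_diff k x)\<^sup>2) \<le> 1 * real (Suc k)"
    using x by (intro mult_mono) auto
  then have "(x * lag_diff k x)\<^sup>2 \<le> real (Suc k)"
    by (simp add: power2_eq_square algebra_simps)
  then have "(real (Suc k))\<^sup>2 * (lag k 1 x)\<^sup>2 \<le> real (Suc k)"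
    unfolding lag_diff_identity by (simp only: power2_minus power_mult_distrib)
  then have "real (Suc k) * (lag k 1 x)\<^sup>2 \<le> 1"
    by (simp add: power2_eq_square mult.assoc del: of_nat_Suc)
  then have "(lag k 1 x)\<^sup>2 \<le> 1 / real (Suc k)"
    by (simp add: field_simps del: of_nat_Suc)
  then have "\<bar>lag k 1 x\<bar> \<le> sqrt (1 / real (Suc k))"
    using real_sqrt_le_mono by fastforce
  then show ?thesis by (simp add: real_sqrt_divide)
qed

text \<open>\<open>V\<^sup>n (I + V)\<^sup>-\<^sup>k 1\<close>; since \<open>(I + V)\<^sup>-\<^sup>1\<close> is conjugate to \<open>I - V\<close> by multiplication with
  \<open>e\<^sup>x\<close>, the functions for \<open>n = 0\<close> are again Laguerre polynomials up to a factor \<open>e^{-x}\<close> and a shift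
  of the index.\<close>

fun wlag :: "nat \<Rightarrow> nat \<Rightarrow> real \<Rightarrow> real" where
  "wlag 0 n x = x^n / fact n"
| "wlag (Suc k) 0 x = exp (-x) * lag k 0 x"
| "wlag (Suc k) (Suc n) x = wlag k n x - wlag (Suc k) n x"

lemma wlag_at_0: "wlag k (Suc n) 0 = 0"
proof (induction n arbitrary: k)
  case 0
  have "wlag k 0 0 = 1" for k by (cases k) (auto simp: lag_at_0)
  then show ?case by (cases k) auto
next
  case (Suc n)
  then show ?case by (cases k) auto
qed

text \<open>The recursion produces level \<open>Suc n\<close> algebraically. That it is a primitive
  rests, for \<open>n = 0\<close>, on \<open>L_(i+1)' = L_i' - L_i\<close>, so that
  \<open>exp (-x) * (L_i - L_(i+1))\<close> has derivative \<open>exp (-x) * L_(i+1)\<close>. Higher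
  levels follow by linearity.\<close>

lemma wlag_deriv: "(wlag k (Suc n) has_real_derivative wlag k n x) (at x)"
proof (cases k)
  case 0
  have eq: "wlag 0 (Suc n) = (\<lambda>x. x^Suc n / fact (Suc n))" by (rule ext) (rule wlag.simps)
  show ?thesis using has_derivative_power_fact [of n x] unfolding 0 eq by (simp only: wlag.simps)
next
  case (Suc m)
  have "(wlag (Suc m) (Suc n) has_real_derivative wlag (Suc m) n x) (at x)"
  proof (induction n arbitrary: m)
    case 0
    show ?case
    proof (cases m)
      case 0
      have "wlag (Suc 0) (Suc 0) = (\<lambda>x. 1 - exp (-x))" by (auto simp: lag_0)
      then show ?thesis unfolding 0
        by (simp add: lag_0) (rule derivative_eq_intros refl | simp)+
    next
      case (Suc i)
      obtain D where D: "(lag i 0 has_real_derivative D) (at x)"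
      proof (cases i)
        case 0
        then show ?thesis using that [of 0] by (simp add: lag_0 [abs_def])
      next
        case (Suc j)
        then show ?thesis using that lag_deriv_0 by blast
      qed
      have D': "(lag (Suc i) 0 has_real_derivative D - lag i 0 x) (at x)"
        unfolding lag_Suc [abs_def] by (intro DERIV_diff D lag_deriv)
      have eq: "wlag (Suc (Suc i)) (Suc 0) = (\<lambda>x. exp (-x) * lag i 0 x - exp (-x) * lag (Suc i) 0 x)"
        by auto
      show ?thesis unfolding Suc eq
        by (rule derivative_eq_intros D D' refl | simp add: algebra_simps)+
    qed
  next
    case (Suc n)
    have "(wlag m (Suc n) has_real_derivative wlag m n x) (at x)"
    proof (cases m)
      case 0
      have eq: "wlag 0 (Suc n) = (\<lambda>x. x^Suc n / fact (Suc n))" by (rule ext) (rule wlag.simps)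
      show ?thesis using has_derivative_power_fact [of n x] unfolding 0 eq by (simp only: wlag.simps)
    qed (use Suc in blast)
    from DERIV_diff [OF this Suc [of m]] show ?case by (simp add: wlag.simps(3)[abs_def])
  qed
  then show ?thesis using Suc by simp
qed

text \<open>Comparison of derivatives: by induction \<open>M * x^n / n!\<close> plus or minus
  \<open>f n\<close> is nondecreasing and starts from a nonnegative value.\<close>

lemma iterated_primitive_bound:
  fixes f :: "nat \<Rightarrow> real \<Rightarrow> real"
  assumes deriv: "\<And>n x. (f (Suc n) has_real_derivative f n x) (at x)"
    and at_0: "\<And>n. f (Suc n) 0 = 0"
    and bound: "\<And>x. 0 \<le> x \<Longrightarrow> x \<le> b \<Longrightarrow> \<bar>f 0 x\<bar> \<le> M"
    and x: "0 \<le> x" "x \<le> b"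
  shows "\<bar>f n x\<bar> \<le> M * (x^n / fact n)"
  using x
proof (induction n arbitrary: x)
  case 0
  then show ?case using bound by simp
next
  case (Suc n)
  have d: "((\<lambda>x. M * (x^Suc n / fact (Suc n))) has_real_derivative M * (t^n / fact n)) (at t)" for t
    by (intro DERIV_cmult has_derivative_power_fact)
  have 1: "M * (0^Suc n / fact (Suc n)) - f (Suc n) 0 \<le> M * (x^Suc n / fact (Suc n)) - f (Suc n) x"
  proof (rule DERIV_nonneg_imp_nondecreasing [OF Suc.prems(1)])
    fix t assume "0 \<le> t" "t \<le> x"
    then have "0 \<le> M * (t^n / fact n) - f n t" using Suc.IH [of t] Suc.prems by linarith
    then show "\<exists>y. ((\<lambda>x. M * (x^Suc n / fact (Suc n)) - f (Suc n) x) has_real_derivative y) (at t) \<and> 0 \<le> y"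
      using DERIV_diff [OF d deriv] by blast
  qed
  have 2: "M * (0^Suc n / fact (Suc n)) + f (Suc n) 0 \<le> M * (x^Suc n / fact (Suc n)) + f (Suc n) x"
  proof (rule DERIV_nonneg_imp_nondecreasing [OF Suc.prems(1)])
    fix t assume "0 \<le> t" "t \<le> x"
    then have "0 \<le> M * (t^n / fact n) + f n t" using Suc.IH [of t] Suc.prems by linarith
    then show "\<exists>y. ((\<lambda>x. M * (x^Suc n / fact (Suc n)) + f (Suc n) x) has_real_derivative y) (at t) \<and> 0 \<le> y"
      using DERIV_add [OF d deriv] by blast
  qed
  from 1 2 show ?case by (simp add: at_0 del: fact_Suc)
qed

text \<open>The iteration starts at the first primitive, since \<open>lag k 0\<close> equals 1 at
  the origin for every \<open>k\<close> and has no uniform decay.\<close>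

lemma lag_bound:
  assumes "0 \<le> b" "b \<le> 1/2"
  shows "\<bar>lag k (Suc n) b\<bar> \<le> 1 / sqrt (Suc k) * (b^n / fact n)"
  using assms lag_1_bound
  by (intro iterated_primitive_bound [where f = "\<lambda>n. lag k (Suc n)" and b = b])
     (auto simp: lag_at_0 intro: lag_deriv)

text \<open>For \<open>k = i + 2\<close> the first primitive is \<open>exp (-x) * lag i 1 x\<close>,
  whence the shift by 2. For \<open>k <= 1\<close> truncated subtraction makes the bound 1, which is
  checked directly.\<close>

lemma wlag_bound:
  assumes "0 \<le> b" "b \<le> 1/2"
  shows "\<bar>wlag k (Suc n) b\<bar> \<le> 1 / sqrt (Suc (k - 2)) * (b^n / fact n)"
proof (rule iterated_primitive_bound [where f = "\<lambda>n. wlag k (Suc n)" and b = b])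
  fix x assume x: "0 \<le> x" "x \<le> b"
  consider "k = 0" | "k = 1" | i where "k = Suc (Suc i)"
    by (metis One_nat_def not0_implies_Suc)
  then show "\<bar>wlag k (Suc 0) x\<bar> \<le> 1 / sqrt (Suc (k - 2))"
  proof cases
    case 3
    have "wlag k (Suc 0) x = exp (-x) * lag i 1 x"
      unfolding 3 by (simp add: lag_Suc algebra_simps)
    also have "\<bar>\<dots>\<bar> \<le> 1 * (1 / sqrt (Suc i))"
      unfolding abs_mult using x assms by (intro mult_mono lag_1_bound) auto
    finally show ?thesis using 3 by simp
  qed (use x assms in \<open>auto simp: lag_0\<close>)
qed (use assms in \<open>auto intro: wlag_deriv wlag_at_0 simp del: wlag.simps\<close>)

section \<open>Quasi-normed sequence spaces\<close>

text \<open>The constant \<open>4\<close> makes it unnecessary to prove Minkowski's inequality for \<open>\<ell>\<^sub>p\<close>.\<close>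

locale seq_quasi_norm =
  fixes X :: "(nat \<Rightarrow> 'a::real_normed_field) set" and N :: "(nat \<Rightarrow> 'a) \<Rightarrow> real"
  assumes add_closed: "x \<in> X \<Longrightarrow> y \<in> X \<Longrightarrow> x + y \<in> X"
    and quasi_triangle: "x \<in> X \<Longrightarrow> y \<in> X \<Longrightarrow> N (x + y) \<le> 4 * (N x + N y)"
    and scale_closed: "x \<in> X \<Longrightarrow> (\<lambda>n. c * x n) \<in> X"
    and N_scale: "x \<in> X \<Longrightarrow> N (\<lambda>n. c * x n) = norm c * N x"
    and N_nonneg: "x \<in> X \<Longrightarrow> 0 \<le> N x"
    and geometric: "(\<And>n. norm (x n) \<le> M * (1/2)^n) \<Longrightarrow> x \<in> X \<and> N x \<le> 2 * M"
    and truncation: "x \<in> X \<Longrightarrow> (\<lambda>m. N (\<lambda>n. if n < m then 0 else x n)) \<longlonglongrightarrow> 0"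
begin

lemma diff_closed: "x \<in> X \<Longrightarrow> y \<in> X \<Longrightarrow> x - y \<in> X"
proof -
  assume "x \<in> X" "y \<in> X"
  then have "x + (\<lambda>n. (-1) * y n) \<in> X" by (intro add_closed scale_closed)
  also have "x + (\<lambda>n. (-1) * y n) = x - y" by auto
  finally show ?thesis .
qed

lemma finite_support_closed:
  assumes "\<And>n. m \<le> n \<Longrightarrow> x n = 0"
  shows "x \<in> X"
proof -
  have "norm (x n) \<le> (\<Sum>i<m. norm (x i) * 2^i) * (1/2)^n" for n
  proof (cases "n < m")
    case True
    then have "norm (x n) * 2^n \<le> (\<Sum>i<m. norm (x i) * 2^i)"
      by (intro member_le_sum) auto
    then show ?thesis by (simp add: field_simps)
  qed (auto simp: assms intro!: mult_nonneg_nonneg sum_nonneg)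
  then show ?thesis using geometric by blast
qed

section \<open>Closures of subspaces and a density criterion\<close>

definition cl :: "(nat \<Rightarrow> 'a) set \<Rightarrow> (nat \<Rightarrow> 'a) set" where
  "cl D = {x \<in> X. \<forall>e>0. \<exists>y\<in>D. N (x - y) < e}"

lemma dense_in_iff_cl: "D \<subseteq> X \<Longrightarrow> dense_in N X D \<longleftrightarrow> X \<subseteq> cl D"
  by (auto simp: dense_in_def cl_def)

lemma cl_cl:
  assumes D: "D \<subseteq> X" and x: "x \<in> X" and appr: "\<And>e. e > 0 \<Longrightarrow> \<exists>y\<in>cl D. N (x - y) < e"
  shows "x \<in> cl D"
  unfolding cl_def
proof (intro CollectI conjI x allI impI)
  fix e :: real assume "e > 0"
  \<comment> \<open>Two errors below \<open>e / 8\<close> add up to less than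
    \<open>4 * (e/8 + e/8) = e\<close>.\<close>
  then have e: "e / 8 > 0" by simp
  obtain y where y: "y \<in> cl D" "N (x - y) < e / 8" using appr e by blast
  then obtain z where z: "z \<in> D" "N (y - z) < e / 8" using e unfolding cl_def by blast
  have "N ((x - y) + (y - z)) \<le> 4 * (N (x - y) + N (y - z))"
    using x y z D by (intro quasi_triangle diff_closed) (auto simp: cl_def)
  also have "\<dots> < e" using y z by simp
  finally show "\<exists>y\<in>D. N (x - y) < e" using z by auto
qed

end

locale seq_subspace = seq_quasi_norm +
  fixes D :: "(nat \<Rightarrow> 'a) set"
  assumes D_sub: "D \<subseteq> X"
    and D_add: "x \<in> D \<Longrightarrow> y \<in> D \<Longrightarrow> x + y \<in> D"
    and D_scale: "x \<in> D \<Longrightarrow> (\<lambda>n. c * x n) \<in> D"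
begin

lemma cl_add: 
  assumes x: "x \<in> cl D" and y: "y \<in> cl D"
  shows "x + y \<in> cl D"
  unfolding cl_def
proof (intro CollectI conjI allI impI)
  show "x + y \<in> X" using x y by (auto simp: cl_def intro: add_closed)
  fix e :: real assume "e > 0"
  then have e: "e / 8 > 0" by simp
  obtain x' where x': "x' \<in> D" "N (x - x') < e / 8" using x e unfolding cl_def by blast
  obtain y' where y': "y' \<in> D" "N (y - y') < e / 8" using y e unfolding cl_def by blast
  have "N ((x - x') + (y - y')) \<le> 4 * (N (x - x') + N (y - y'))"
    using x x' y y' D_sub by (intro quasi_triangle diff_closed) (auto simp: cl_def)
  also have "\<dots> < e" using x' y' by simp
  also have "(x - x') + (y - y') = (x + y) - (x' + y')" by (simp add: algebra_simps)
  finally show "\<exists>z\<in>D. N (x + y - z) < e" using D_add x' y' by blast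
qed

lemma cl_scale:
  assumes x: "x \<in> cl D"
  shows "(\<lambda>n. c * x n) \<in> cl D"
  unfolding cl_def
proof (intro CollectI conjI allI impI)
  show "(\<lambda>n. c * x n) \<in> X" using x by (auto simp: cl_def intro: scale_closed)
  fix e :: real assume "e > 0"
  then have e: "e / (norm c + 1) > 0" by (simp add: add_nonneg_pos)
  obtain y where y: "y \<in> D" "N (x - y) < e / (norm c + 1)" using x e unfolding cl_def by blast
  have xy: "x - y \<in> X" using x y D_sub by (intro diff_closed) (auto simp: cl_def)
  have "N ((\<lambda>n. c * x n) - (\<lambda>n. c * y n)) = N (\<lambda>n. c * (x - y) n)"
    by (rule arg_cong [where f = N]) (auto simp: algebra_simps)
  also have "\<dots> = norm c * N (x - y)" using N_scale [OF xy] .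
  also have "\<dots> \<le> (norm c + 1) * N (x - y)"
    using N_nonneg [OF xy] by (intro mult_right_mono) auto
  also have "\<dots> < e"
    using y by (simp add: pos_less_divide_eq add_nonneg_pos mult.commute)
  finally show "\<exists>z\<in>D. N ((\<lambda>n. c * x n) - z) < e" using D_scale y by blast
qed

lemma subset_cl: "D \<subseteq> cl D"
proof
  fix x assume x: "x \<in> D"
  have "x - x \<in> X \<and> N (x - x) \<le> 2 * 0" by (rule geometric) simp
  with x D_sub show "x \<in> cl D" by (force simp: cl_def)
qed

lemma cl_diff:
  assumes "x \<in> cl D" "y \<in> cl D"
  shows "x - y \<in> cl D"
proof -
  have "x + (\<lambda>n. (-1) * y n) \<in> cl D" using assms by (intro cl_add cl_scale)
  also have "x + (\<lambda>n. (-1) * y n) = x - y" by auto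
  finally show ?thesis .
qed

lemma cl_truncate:
  assumes units: "\<And>i a. i < m \<Longrightarrow> (\<lambda>n. if n = i then a else 0) \<in> cl D" and ne: "D \<noteq> {}"
  shows "(\<lambda>n. if n < m then x n else 0) \<in> cl D"
  using units
proof (induction m)
  case 0
  obtain y where "y \<in> D" using ne by blast
  then have "(\<lambda>n. 0 * y n) \<in> cl D" using subset_cl by (intro cl_scale) auto
  then show ?case by simp
next
  case (Suc m)
  have "(\<lambda>n. if n < m then x n else 0) + (\<lambda>n. if n = m then x m else 0) \<in> cl D"
    using Suc by (intro cl_add) auto
  also have "(\<lambda>n. if n < m then x n else 0) + (\<lambda>n. if n = m then x m else 0)
      = (\<lambda>n. if n < Suc m then x n else 0)" by (auto simp: less_Suc_eq)
  finally show ?case .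
qed

text \<open>If \<open>v\<^sub>0, \<dots>, v\<^sub>m\<^sub>-\<^sub>1\<close> are in the closure, where \<open>v\<^sub>n = c\<^sub>n e\<^sub>n\<close>, then so is the limit \<open>v\<^sub>m\<close> of
  \<open>(\<Sum>n\<ge>m. b\<^sup>n\<^sup>+\<^sup>1 v\<^sub>n) / b\<^sup>m\<^sup>+\<^sup>1\<close> as \<open>b\<close> tends to \<open>0\<close>.\<close>

lemma power_family_dense:
  fixes c :: "nat \<Rightarrow> 'a"
  assumes c: "\<And>n. c n \<noteq> 0" and c_le: "\<And>n. norm (c n) \<le> K * A^n" and A: "A > 0"
    and b0: "b0 > 0"
    and fam: "\<And>b. 0 < b \<Longrightarrow> b \<le> b0 \<Longrightarrow> (\<lambda>n. of_real (b^Suc n) * c n) \<in> D"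
  shows "dense_in N X D"
proof -
  have ne: "D \<noteq> {}" using fam [of b0] b0 by auto
  have K: "0 \<le> K" using order_trans [OF norm_ge_zero c_le [of 0]] by simp
  have units: "(\<lambda>n. if n = m then a else 0) \<in> cl D" for m a
  proof (induction m arbitrary: a rule: less_induct)
    case (less m)
    show ?case
    proof (rule cl_cl [OF D_sub])
      show "(\<lambda>n. if n = m then a else 0) \<in> X"
        by (rule finite_support_closed [of "Suc m"]) auto
      fix e :: real assume e: "e > 0"
      \<comment> \<open>In the coordinate \<open>n = m + 1 + i\<close> of the error,
        \<open>b <= 1 / (2 * A)\<close> is used for all but one of the powers of \<open>b\<close>.
        What remains is at most \<open>Q * b * (1/2)^n\<close>, and the last bound on
        \<open>b\<close> then gives \<open>2 * (Q * b) < e\<close>.\<close>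
      define Q where "Q = norm a / norm (c m) * K * (2 * A)^Suc m"
      have Q: "Q \<ge> 0" using K A by (auto simp: Q_def)
      define b where "b = min (min b0 (1 / (2 * A))) (e / (2 * (Q + 1)))"
      have b: "b > 0" "b \<le> b0" "b \<le> 1 / (2 * A)" "b \<le> e / (2 * (Q + 1))"
        using b0 A e Q by (auto simp: b_def)
      define s where "s = a / (of_real (b^Suc m) * c m)"
      define y where "y = (\<lambda>n. s * ((\<lambda>n. of_real (b^Suc n) * c n)
          - (\<lambda>n. if n < m then of_real (b^Suc n) * c n else 0)) n)"
      have "y \<in> cl D" unfolding y_def
        using fam [OF b(1,2)] subset_cl by (intro cl_scale cl_diff cl_truncate ne less) auto
      moreover
      have "norm (((\<lambda>n. if n = m then a else 0) - y) n) \<le> (Q * b) * (1/2)^n" for n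
      proof (cases "n \<le> m")
        case True
        have "((\<lambda>n. if n = m then a else 0) - y) n = 0"
          using True b c [of m] by (auto simp: y_def s_def)
        then show ?thesis using Q b by simp
      next
        case False
        then obtain i where i: "n = Suc (m + i)" by (metis less_imp_Suc_add not_le)
        have "((\<lambda>n. if n = m then a else 0) - y) n = - (a / c m * of_real (b^Suc i) * c n)"
          using b c [of m] by (simp add: y_def s_def i power_add field_simps)
        then have "norm (((\<lambda>n. if n = m then a else 0) - y) n) = norm a / norm (c m) * b^Suc i * norm (c n)"
          using b by (simp add: norm_mult norm_divide norm_power)
        also have "\<dots> \<le> norm a / norm (c m) * (b * (1 / (2 * A))^i) * (K * A^n)"
          using b A by (intro mult_mono c_le) (auto intro!: power_mono)
        also have "\<dots> = Q * b * (1/2)^n"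
          using A by (simp add: Q_def i power_add power_mult_distrib field_simps)
        finally show ?thesis .
      qed
      then have "N ((\<lambda>n. if n = m then a else 0) - y) \<le> 2 * (Q * b)"
        using geometric by blast
      moreover have "2 * (Q * b) < e"
      proof -
        have "b * (2 * (Q + 1)) \<le> e" using b(4) Q by (subst (asm) pos_le_divide_eq) auto
        then show ?thesis using b(1) by (simp add: algebra_simps)
      qed
      ultimately show "\<exists>y\<in>cl D. N ((\<lambda>n. if n = m then a else 0) - y) < e" by force
    qed
  qed
  show ?thesis
    unfolding dense_in_iff_cl [OF D_sub]
  proof
    fix x assume x: "x \<in> X"
    show "x \<in> cl D"
    proof (rule cl_cl [OF D_sub x])
      fix e :: real assume "e > 0"
      then have "eventually (\<lambda>m. N (\<lambda>n. if n < m then 0 else x n) < e) sequentially"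
        using truncation [OF x] by (rule order_tendstoD(2) [rotated])
      then obtain m where m: "N (\<lambda>n. if n < m then 0 else x n) < e"
        by (auto simp: eventually_sequentially)
      have "x - (\<lambda>n. if n < m then x n else 0) = (\<lambda>n. if n < m then 0 else x n)" by auto
      with m cl_truncate [OF units ne, of m x] show "\<exists>y\<in>cl D. N (x - y) < e" by metis
    qed
  qed
qed

end

section \<open>The spaces l_p and c_0\<close>

lemma lp_quasi_norm:
  assumes p: "1 \<le> p"
  shows "seq_quasi_norm (lp_space p :: (nat \<Rightarrow> 'a::real_normed_field) set) (lp_norm p)"
proof
  fix x y :: "nat \<Rightarrow> 'a" and c :: 'a and M :: real
  {
    assume x: "x \<in> lp_space p" and y: "y \<in> lp_space p"
    have le: "norm ((x + y) n) powr p \<le> 2 powr p * (norm (x n) powr p + norm (y n) powr p)" for n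
    proof -
      have "norm ((x + y) n) powr p \<le> (2 * max (norm (x n)) (norm (y n))) powr p"
        using p norm_triangle_ineq [of "x n" "y n"] by (intro powr_mono2) (auto simp: max_def)
      also have "\<dots> = 2 powr p * max (norm (x n)) (norm (y n)) powr p"
        by (simp add: powr_mult)
      also have "max (norm (x n)) (norm (y n)) powr p \<le> norm (x n) powr p + norm (y n) powr p"
        by (simp add: max_def)
      finally show ?thesis by simp
    qed
    have s: "summable (\<lambda>n. 2 powr p * (norm (x n) powr p + norm (y n) powr p))"
      using x y by (intro summable_mult summable_add) (auto simp: lp_space_def)
    have s': "summable (\<lambda>n. norm ((x + y) n) powr p)"
      using le by (intro summable_comparison_test' [OF s, of 0]) auto
    then show "x + y \<in> lp_space p" by (simp add: lp_space_def)
    define P where "P = (\<Sum>n. norm (x n) powr p)"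
    define Q where "Q = (\<Sum>n. norm (y n) powr p)"
    have PQ: "P \<ge> 0" "Q \<ge> 0"
      using x y by (auto simp: P_def Q_def lp_space_def intro!: suminf_nonneg)
    have "(\<Sum>n. norm ((x + y) n) powr p) \<le> (\<Sum>n. 2 powr p * (norm (x n) powr p + norm (y n) powr p))"
      by (rule suminf_le [OF le s' s])
    also have "\<dots> = 2 powr p * (P + Q)"
      using x y unfolding P_def Q_def lp_space_def
      by (subst suminf_mult) (auto intro!: summable_add simp: suminf_add)
    \<comment> \<open>A factor \<open>2 powr p\<close> instead of 2 is affordable and makes the
      \<open>p\<close>-th root come out as exactly 4.\<close>
    also have "\<dots> \<le> 2 powr p * (2 powr p * max P Q)"
    proof -
      have "2 \<le> 2 powr p" using powr_mono [OF p, of 2] by simp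
      then have "2 * max P Q \<le> 2 powr p * max P Q" using PQ by (intro mult_right_mono) auto
      then have "P + Q \<le> 2 powr p * max P Q" by (auto simp: max_def split: if_splits)
      then show ?thesis by simp
    qed
    finally have "lp_norm p (x + y) \<le> (2 powr p * (2 powr p * max P Q)) powr (1/p)"
      unfolding lp_norm_def using p s' by (intro powr_mono2 suminf_nonneg) auto
    also have "\<dots> = 4 * max P Q powr (1/p)"
      using p PQ by (simp add: powr_mult powr_powr)
    also have "max P Q powr (1/p) \<le> P powr (1/p) + Q powr (1/p)"
      by (simp add: max_def)
    finally show "lp_norm p (x + y) \<le> 4 * (lp_norm p x + lp_norm p y)"
      by (simp add: lp_norm_def P_def Q_def)
  }
  {
    assume x: "x \<in> lp_space p"
    then have s: "summable (\<lambda>n. norm (x n) powr p)" by (simp add: lp_space_def)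
    have eq: "norm (c * x n) powr p = norm c powr p * norm (x n) powr p" for n
      by (simp add: norm_mult powr_mult)
    show "(\<lambda>n. c * x n) \<in> lp_space p"
      using s by (simp add: lp_space_def eq summable_mult)
    show "lp_norm p (\<lambda>n. c * x n) = norm c * lp_norm p x"
      using p s unfolding lp_norm_def eq
      by (simp add: suminf_mult powr_mult suminf_nonneg powr_powr)
    show "0 \<le> lp_norm p x" by (simp add: lp_norm_def)
    have tail: "(\<Sum>n. norm (if n < m then 0 else x n) powr p) = (\<Sum>n. norm (x (n + m)) powr p)" for m
    proof -
      have "summable (\<lambda>n. norm (if n < m then 0 else x n) powr p)"
        by (rule summable_comparison_test' [OF s, of 0]) auto
      from suminf_split_initial_segment [OF this, of m] show ?thesis using p by simp
    qed
    have "(\<lambda>m. (\<Sum>n. norm (x (n + m)) powr p)) \<longlonglongrightarrow> 0"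
      using suminf_exist_split2 [OF s] .
    then have "(\<lambda>m. (\<Sum>n. norm (x (n + m)) powr p) powr (1/p)) \<longlonglongrightarrow> 0 powr (1/p)"
      using p s by (intro tendsto_powr') (auto intro!: always_eventually suminf_nonneg summable_ignore_initial_segment[of "\<lambda>n. norm (x n) powr p"])
    then show "(\<lambda>m. lp_norm p (\<lambda>n. if n < m then 0 else x n)) \<longlonglongrightarrow> 0"
      by (simp add: lp_norm_def tail)
  }
  {
    assume le: "\<And>n. norm (x n) \<le> M * (1/2)^n"
    have M: "0 \<le> M" using order_trans [OF norm_ge_zero le [of 0]] by simp
    have le': "norm (x n) powr p \<le> M powr p * (1/2)^n" for n
    proof -
      have "norm (x n) powr p \<le> (M * (1/2)^n) powr p"
        using le p by (intro powr_mono2) auto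
      also have "\<dots> = M powr p * ((1/2)^n) powr p"
        using M by (simp add: powr_mult)
      also have "((1/2::real)^n) powr p \<le> ((1/2)^n) powr 1"
        using p by (intro powr_mono') (auto simp: power_le_one)
      finally show ?thesis using M by (simp add: mult_left_mono)
    qed
    have s: "summable (\<lambda>n. M powr p * (1/2::real)^n)"
      by (intro summable_mult summable_geometric) simp
    have s': "summable (\<lambda>n. norm (x n) powr p)"
      using le' by (intro summable_comparison_test' [OF s, of 0]) auto
    have "(\<Sum>n. norm (x n) powr p) \<le> (\<Sum>n. M powr p * (1/2)^n)"
      by (rule suminf_le [OF le' s' s])
    also have "\<dots> = 2 * M powr p"
      by (subst suminf_mult) (auto simp: suminf_geometric)
    also have "\<dots> \<le> 2 powr p * M powr p"
      using powr_mono [OF p, of 2] by (intro mult_right_mono) auto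
    finally have "lp_norm p x \<le> (2 powr p * M powr p) powr (1/p)"
      unfolding lp_norm_def using p s' by (intro powr_mono2 suminf_nonneg) auto
    also have "\<dots> = 2 * M" using p M by (simp add: powr_mult powr_powr)
    finally show "x \<in> lp_space p \<and> lp_norm p x \<le> 2 * M" using s' by (simp add: lp_space_def)
  }
qed

lemma c0_quasi_norm:
  "seq_quasi_norm (c0_space :: (nat \<Rightarrow> 'a::real_normed_field) set) c0_norm"
proof -
  have bdd: "bdd_above (range (\<lambda>n. norm (x n)))" if "x \<in> c0_space" for x :: "nat \<Rightarrow> 'a"
    using that convergent_imp_Bseq [of x]
    by (auto simp: c0_space_def convergent_def bdd_above_def Bseq_def)
  have upper: "norm (x n) \<le> c0_norm x" if "x \<in> c0_space" for x :: "nat \<Rightarrow> 'a" and n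
    unfolding c0_norm_def by (rule cSUP_upper [OF UNIV_I bdd [OF that]])
  have least: "c0_norm x \<le> B" if "\<And>n. norm (x n) \<le> B" for x :: "nat \<Rightarrow> 'a" and B
    unfolding c0_norm_def using that by (intro cSUP_least) auto
  have nonneg: "0 \<le> c0_norm x" if "x \<in> c0_space" for x :: "nat \<Rightarrow> 'a"
    using upper [OF that, of 0] norm_ge_zero order_trans by blast
  show ?thesis
  proof
    fix x y :: "nat \<Rightarrow> 'a" and c :: 'a and M :: real
    {
      assume x: "x \<in> c0_space" and y: "y \<in> c0_space"
      show "x + y \<in> c0_space"
        using x y tendsto_add [of x 0 sequentially y 0] by (simp add: c0_space_def plus_fun_def)
      have "c0_norm (x + y) \<le> c0_norm x + c0_norm y"
        using upper [OF x] upper [OF y] by (intro least) (auto intro: norm_triangle_le add_mono)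
      then show "c0_norm (x + y) \<le> 4 * (c0_norm x + c0_norm y)"
        using nonneg [OF x] nonneg [OF y] by simp
    }
    {
      assume x: "x \<in> c0_space"
      have scale: "(\<lambda>n. d * z n) \<in> c0_space" if "z \<in> c0_space" for z :: "nat \<Rightarrow> 'a" and d
        using that tendsto_mult_right_zero [of z sequentially d] by (simp add: c0_space_def)
      show cx: "(\<lambda>n. c * x n) \<in> c0_space" using scale [OF x] .
      have le: "c0_norm (\<lambda>n. d * z n) \<le> norm d * c0_norm z" if "z \<in> c0_space" for z :: "nat \<Rightarrow> 'a" and d
        using upper [OF that] by (intro least) (simp add: norm_mult mult_left_mono)
      show "c0_norm (\<lambda>n. c * x n) = norm c * c0_norm x"
      proof (cases "c = 0")
        case True
        then show ?thesis by (simp add: c0_norm_def)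
      next
        case False
        \<comment> \<open>The reverse inequality is \<open>le\<close> for the scaled sequence and
          the scalar \<open>inverse c\<close>.\<close>
        have "c0_norm x \<le> norm (inverse c) * c0_norm (\<lambda>n. c * x n)"
          using le [OF cx, of "inverse c"] False by (simp add: mult.assoc [symmetric])
        then have "norm c * c0_norm x \<le> norm c * (norm (inverse c) * c0_norm (\<lambda>n. c * x n))"
          by (intro mult_left_mono) auto
        also have "\<dots> = c0_norm (\<lambda>n. c * x n)"
          using False by (simp add: norm_inverse)
        finally have "norm c * c0_norm x \<le> c0_norm (\<lambda>n. c * x n)" .
        with le [OF x, of c] show ?thesis by simp
      qed
      show "0 \<le> c0_norm x" by (rule nonneg [OF x])
      show "(\<lambda>m. c0_norm (\<lambda>n. if n < m then 0 else x n)) \<longlonglongrightarrow> 0"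
      proof (rule LIMSEQ_I)
        fix r :: real assume r: "0 < r"
        from x obtain m0 where m0: "\<And>n. n \<ge> m0 \<Longrightarrow> norm (x n) < r / 2"
          using LIMSEQ_D [of x 0 "r / 2"] r by (auto simp: c0_space_def)
        have "norm (c0_norm (\<lambda>n. if n < m then 0 else x n) - 0) < r" if m: "m \<ge> m0" for m
        proof -
          have le: "c0_norm (\<lambda>n. if n < m then 0 else x n) \<le> r / 2"
            using m0 m r by (intro least) (auto simp: less_imp_le)
          have "(\<lambda>n. if n < m then 0 else x n) \<in> c0_space"
            unfolding c0_space_def mem_Collect_eq
            by (rule Lim_transform_eventually [of x])
               (use x in \<open>auto simp: c0_space_def eventually_sequentially intro!: exI [of _ m]\<close>)
          from nonneg [OF this] le r show ?thesis by simp
        qed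
        then show "\<exists>no. \<forall>m\<ge>no. norm (c0_norm (\<lambda>n. if n < m then 0 else x n) - 0) < r" by blast
      qed
    }
    {
      assume le: "\<And>n. norm (x n) \<le> M * (1/2)^n"
      have M: "0 \<le> M" using order_trans [OF norm_ge_zero le [of 0]] by simp
      have "(\<lambda>n. M * (1/2)^n) \<longlonglongrightarrow> 0"
        by (intro tendsto_mult_right_zero LIMSEQ_realpow_zero) auto
      then have "x \<longlonglongrightarrow> 0" by (rule Lim_null_comparison [rotated]) (simp add: le)
      moreover have "c0_norm x \<le> 2 * M"
      proof (rule least)
        fix n
        have "M * (1/2)^n \<le> M * 1" using M by (intro mult_left_mono) (auto simp: power_le_one)
        with le [of n] M show "norm (x n) \<le> 2 * M" by simp
      qed
      ultimately show "x \<in> c0_space \<and> c0_norm x \<le> 2 * M" by (simp add: c0_space_def)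
    }
  qed
qed

section \<open>Weighted shifts\<close>

text \<open>For a difference in the kernel, the products \<open>w_1 ... w_n\<close> times its
  coordinates only alternate in sign. A null sequence of constant modulus vanishes.\<close>

lemma inj_id_plus_bw_shift:
  fixes w :: "nat \<Rightarrow> 'a::real_normed_field"
  assumes w: "\<And>n. n \<ge> 1 \<Longrightarrow> w n \<noteq> 0"
    and x: "(\<lambda>n. (\<Prod>j=1..n. w j) * x n) \<longlonglongrightarrow> 0" and y: "(\<lambda>n. (\<Prod>j=1..n. w j) * y n) \<longlonglongrightarrow> 0"
    and eq: "x + bw_shift w x = y + bw_shift w y"
  shows "x = y"
proof
  fix m
  define f where "f = (\<lambda>n. (\<Prod>j=1..n. w j) * (x n - y n))"
  have "f (Suc n) = - f n" for n
  proof -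
    have "x n - y n + w (Suc n) * (x (Suc n) - y (Suc n)) = 0"
      using fun_cong [OF eq, of n] by (simp add: bw_shift_def algebra_simps)
    then have "(\<Prod>j=1..n. w j) * (x n - y n + w (Suc n) * (x (Suc n) - y (Suc n))) = 0" by simp
    then show ?thesis
      by (simp add: f_def algebra_simps add_eq_0_iff)
  qed
  then have const: "norm (f n) = norm (f 0)" for n by (induction n) auto
  have "f \<longlonglongrightarrow> 0" using tendsto_diff [OF x y] by (simp add: f_def algebra_simps)
  then have "(\<lambda>n. norm (f n)) \<longlonglongrightarrow> 0" by (rule tendsto_norm_zero)
  then have "(\<lambda>n. norm (f 0)) \<longlonglongrightarrow> 0" by (subst (asm) const)
  then have "norm (f 0) = 0" using LIMSEQ_const_iff by blast
  with const [of m] have "f m = 0" by simp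
  moreover have "(\<Prod>j=1..m. w j) \<noteq> 0" using w by simp
  ultimately show "x m = y m" by (simp add: f_def)
qed

lemma liminf_root_pos_imp_geometric_bound:
  fixes a :: "nat \<Rightarrow> real"
  assumes a: "\<And>n. a n > 0" and lim: "liminf (\<lambda>n. ereal (a n powr (1 / real n))) > 0"
  obtains d K where "d > 0" "\<And>n. d^n \<le> K * a n"
proof -
  obtain d' where d': "0 < d'" "d' < liminf (\<lambda>n. ereal (a n powr (1 / real n)))"
    using lim dense by blast
  then obtain d where d: "d' = ereal d" by (cases d') auto
  with d' have d0: "d > 0" by simp
  have "eventually (\<lambda>n. ereal d < ereal (a n powr (1 / real n))) sequentially"
    using d' d less_LiminfD by blast
  then obtain n0 where n0: "\<And>n. n \<ge> n0 \<Longrightarrow> d < a n powr (1 / real n)"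
    by (auto simp: eventually_sequentially)
  \<comment> \<open>The sum handles the indices up to \<open>n0\<close>, always including
    \<open>n = 0\<close>, where \<open>1 / real n\<close> is 0 and the root carries no information.
    The summand 1 serves the remaining indices.\<close>
  define K where "K = 1 + (\<Sum>i\<le>n0. d^i / a i)"
  have K1: "K \<ge> 1" unfolding K_def using d0 a by (auto intro!: sum_nonneg simp: less_imp_le)
  have "d^n \<le> K * a n" for n
  proof (cases "n \<le> n0")
    case True
    have "d^n / a n \<le> (\<Sum>i\<le>n0. d^i / a i)"
      using True d0 a by (intro member_le_sum) (auto simp: less_imp_le)
    then have "d^n / a n \<le> K" by (simp add: K_def)
    then show ?thesis using a [of n] by (simp add: pos_divide_le_eq)
  next
    case False
    then have n: "n > 0" by simp
    have "d^n = d powr real n" using d0 by (simp add: powr_realpow)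
    also have "\<dots> \<le> (a n powr (1 / real n)) powr real n"
      using n0 [of n] False d0 by (intro powr_mono2) auto
    also have "\<dots> = a n" using n a [of n] by (simp add: powr_powr)
    also have "\<dots> \<le> K * a n" using K1 a [of n] by simp
    finally show ?thesis .
  qed
  with d0 that show thesis by blast
qed

lemma (in seq_quasi_norm) tendsto_N_add:
  assumes "\<And>k. x k \<in> X" "\<And>k. y k \<in> X" "(\<lambda>k::nat. N (x k)) \<longlonglongrightarrow> 0" "(\<lambda>k. N (y k)) \<longlonglongrightarrow> 0"
  shows "(\<lambda>k. N (x k + y k)) \<longlonglongrightarrow> 0"
proof (rule Lim_null_comparison)
  show "eventually (\<lambda>k. norm (N (x k + y k)) \<le> 4 * (N (x k) + N (y k))) sequentially"
    using quasi_triangle N_nonneg [OF add_closed] assms(1,2)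
    by (intro always_eventually allI) (simp only: real_norm_def abs_of_nonneg)
  show "(\<lambda>k. 4 * (N (x k) + N (y k))) \<longlonglongrightarrow> 0"
    using tendsto_mult_right_zero [OF tendsto_add_zero [OF assms(3,4)]] .
qed

lemma (in seq_quasi_norm) tendsto_N_scale:
  assumes "\<And>k. x k \<in> X" "(\<lambda>k::nat. N (x k)) \<longlonglongrightarrow> 0"
  shows "(\<lambda>k. N (\<lambda>n. c * x k n)) \<longlonglongrightarrow> 0"
  using assms by (simp add: N_scale tendsto_mult_right_zero)

lemma bw_shift_add: "bw_shift w (x + y) = bw_shift w x + bw_shift w y"
  by (auto simp: bw_shift_def algebra_simps)

lemma bw_shift_scale: "bw_shift w (\<lambda>n. c * x n) = (\<lambda>n. c * bw_shift w x n)"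
  by (auto simp: bw_shift_def algebra_simps)

lemma tendsto_inverse_sqrt_shift: "(\<lambda>k. 1 / sqrt (real (Suc (k - m)))) \<longlonglongrightarrow> 0"
proof (rule LIMSEQ_offset [where k = m])
  have "(\<lambda>k. inverse (sqrt (real (Suc k)))) \<longlonglongrightarrow> 0"
    by (intro tendsto_inverse_0_at_top filterlim_compose [OF sqrt_at_top]
        filterlim_compose [OF filterlim_real_sequentially] filterlim_Suc)
  then show "(\<lambda>k. 1 / sqrt (real (Suc (k + m - m)))) \<longlonglongrightarrow> 0" by (simp add: inverse_eq_divide)
qed

section \<open>The Kitai Criterion under a geometric lower bound on the weights\<close>

locale weighted_shift_geometric = seq_quasi_norm +
  fixes w :: "nat \<Rightarrow> 'a" and d K :: real
  assumes w_nonzero: "n \<ge> 1 \<Longrightarrow> w n \<noteq> 0"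
    and d_pos: "d > 0"
    and weights_ge: "d^n \<le> K * (fact n * (\<Prod>j=1..n. norm (w j)))"
begin

definition W :: "nat \<Rightarrow> 'a" where "W n = (\<Prod>j=1..n. w j)"

text \<open>In the coordinates \<open>f\<close> the weighted shift becomes the unweighted one.\<close>

definition vec :: "(nat \<Rightarrow> real) \<Rightarrow> nat \<Rightarrow> 'a" where "vec f = (\<lambda>n. of_real (f n) / W n)"

text \<open>\<open>T\<close> stands for the operator \<open>I + T\<close> of the informal statement.\<close>

definition T :: "(nat \<Rightarrow> 'a) \<Rightarrow> nat \<Rightarrow> 'a" where "T x = x + bw_shift w x"

lemma W_nonzero: "W n \<noteq> 0"
  using w_nonzero by (simp add: W_def)

lemma weights_ge': "d^n \<le> K * (fact n * norm (W n))"
  using weights_ge [of n] by (simp add: W_def prod_norm)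

lemma K_nonneg: "0 \<le> K"
proof -
  have "1 \<le> K * norm (W 0)" using weights_ge' [of 0] by simp
  then show ?thesis by (simp add: W_def)
qed

lemma inverse_W_le: "1 / (fact n * norm (W n)) \<le> K * (1/d)^n"
proof -
  have "fact n * norm (W n) > 0" using W_nonzero by simp
  then show ?thesis using weights_ge' [of n] d_pos by (simp add: field_simps)
qed

text \<open>The weight \<open>w (Suc n)\<close> cancels against \<open>W (Suc n)\<close>. The
  resulting sum is matched by \<open>lag_Suc\<close>, up to signs, and by the last equation of
  \<open>wlag\<close>.\<close>

lemma T_vec: "T (vec f) = vec (\<lambda>n. f n + f (Suc n))"
proof
  fix n
  have "W (Suc n) = W n * w (Suc n)" by (simp add: W_def)
  then show "T (vec f) n = vec (\<lambda>n. f n + f (Suc n)) n"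
    using w_nonzero [of "Suc n"] W_nonzero [of n]
    by (simp add: T_def vec_def bw_shift_def field_simps)
qed

lemma T_add: "T (x + y) = T x + T y"
  by (simp add: T_def bw_shift_add algebra_simps)

lemma T_scale: "T (\<lambda>n. c * x n) = (\<lambda>n. c * T x n)"
  by (auto simp: T_def bw_shift_scale algebra_simps)

lemma T_funpow_add: "(T ^^ k) (x + y) = (T ^^ k) x + (T ^^ k) y"
  by (induction k) (simp_all add: T_add del: plus_fun_apply)

lemma T_funpow_scale: "(T ^^ k) (\<lambda>n. c * x n) = (\<lambda>n. c * (T ^^ k) x n)"
  by (induction k) (auto simp: T_scale)

text \<open>The \<open>1 / n!\<close> in the hypothesis cancels the factorial that the growth
  condition allows in \<open>1 / W n\<close>. What is left is \<open>(b / d)^n\<close>, at most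
  \<open>(1/2)^n\<close> as \<open>geometric\<close> demands.\<close>

lemma vec_bound:
  assumes f: "\<And>n. \<bar>f n\<bar> \<le> M * (b^n / fact n)" and b: "0 \<le> b" "b \<le> d / 2"
  shows "vec f \<in> X" "N (vec f) \<le> 2 * (M * K)"
proof -
  have M: "0 \<le> M" using f [of 0] by simp
  have "norm (vec f n) \<le> (M * K) * (1/2)^n" for n
  proof -
    have "norm (vec f n) = \<bar>f n\<bar> / norm (W n)" by (simp add: vec_def norm_divide)
    also have "\<dots> \<le> M * (b^n / fact n) / norm (W n)"
      by (intro divide_right_mono f) simp
    also have "\<dots> = M * b^n * (1 / (fact n * norm (W n)))" by simp
    also have "\<dots> \<le> M * b^n * (K * (1/d)^n)"
      using M b by (intro mult_left_mono inverse_W_le) auto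
    also have "\<dots> = M * K * (b / d)^n" by (simp add: power_divide)
    also have "\<dots> \<le> M * K * (1/2)^n"
      using M K_nonneg b d_pos by (intro mult_left_mono power_mono) (auto simp: field_simps)
    finally show ?thesis .
  qed
  then show "vec f \<in> X" "N (vec f) \<le> 2 * (M * K)" using geometric by blast+
qed

lemma vec_tendsto:
  fixes f :: "nat \<Rightarrow> nat \<Rightarrow> real"
  assumes f: "\<And>k n. \<bar>f k n\<bar> \<le> M k * (b^n / fact n)" and b: "0 \<le> b" "b \<le> d / 2" and M: "M \<longlonglongrightarrow> 0"
  shows "(\<lambda>k. N (vec (f k))) \<longlonglongrightarrow> 0"
proof (rule Lim_null_comparison)
  show "eventually (\<lambda>k. norm (N (vec (f k))) \<le> 2 * (M k * K)) sequentially"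
    using vec_bound [OF f b] by (intro always_eventually allI) (simp add: N_nonneg)
  show "(\<lambda>k. 2 * (M k * K)) \<longlonglongrightarrow> 0"
    by (intro tendsto_mult_right_zero tendsto_mult_left_zero M)
qed

text \<open>Serves both dense sets, with \<open>s = -1\<close> for forward and \<open>s = 1\<close>
  for backward orbits. The bound \<open>1/2\<close> on \<open>b\<close> is the range of the Laguerre
  estimate, \<open>d/2\<close> that of \<open>vec_bound\<close>.\<close>

lemma dense_of_sign_family:
  assumes D: "D \<subseteq> X" "\<And>x y. x \<in> D \<Longrightarrow> y \<in> D \<Longrightarrow> x + y \<in> D" "\<And>c x. x \<in> D \<Longrightarrow> (\<lambda>n. c * x n) \<in> D"
    and s: "\<bar>s\<bar> = 1"
    and fam: "\<And>b. 0 < b \<Longrightarrow> b \<le> min (1/2) (d/2) \<Longrightarrow> vec (\<lambda>n. s^n * (b^Suc n / fact (Suc n))) \<in> D"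
  shows "dense_in N X D"
proof -
  interpret seq_subspace X N D
    by unfold_locales (use D in auto)
  show ?thesis
  proof (rule power_family_dense [where c = "vec (\<lambda>n. s^n / fact (Suc n))" and K = K and A = "1/d" and ?b0.0 = "min (1/2) (d/2)"])
    show "vec (\<lambda>n. s^n / fact (Suc n)) n \<noteq> 0" for n
      using s W_nonzero [of n] by (auto simp: vec_def simp del: fact_Suc)
    show "norm (vec (\<lambda>n. s^n / fact (Suc n)) n) \<le> K * (1/d)^n" for n
    proof -
      have "norm (vec (\<lambda>n. s^n / fact (Suc n)) n) = 1 / (fact (Suc n) * norm (W n))"
        using s by (simp add: vec_def norm_divide power_abs abs_divide del: fact_Suc of_real_divide)
      also have "\<dots> \<le> 1 / (fact n * norm (W n))"
        using W_nonzero by (intro divide_left_mono mult_right_mono fact_mono) auto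
      finally show ?thesis using inverse_W_le [of n] by simp
    qed
    fix b :: real assume "0 < b" "b \<le> min (1/2) (d/2)"
    from fam [OF this] show "(\<lambda>n. of_real (b^Suc n) * vec (\<lambda>n. s^n / fact (Suc n)) n) \<in> D"
      by (simp add: vec_def mult_ac)
  qed (use d_pos in auto)
qed

text \<open>The whole orbit is required to lie in \<open>X\<close> so that the quasi-norm laws apply
  at every time \<open>k\<close>.\<close>

definition forward_null :: "(nat \<Rightarrow> 'a) set" where
  "forward_null = {x. (\<forall>k. (T ^^ k) x \<in> X) \<and> (\<lambda>k. N ((T ^^ k) x)) \<longlonglongrightarrow> 0}"

lemma forward_null_dense: "dense_in N X forward_null"
proof (rule dense_of_sign_family [where s = "-1"])
  show "forward_null \<subseteq> X"
  proof
    fix x assume "x \<in> forward_null"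
    then have "(T ^^ 0) x \<in> X" unfolding forward_null_def by blast
    then show "x \<in> X" by simp
  qed
  show "x + y \<in> forward_null" if "x \<in> forward_null" "y \<in> forward_null" for x y
    using that by (auto simp: forward_null_def T_funpow_add intro: add_closed tendsto_N_add)
  show "(\<lambda>n. c * x n) \<in> forward_null" if "x \<in> forward_null" for c x
    using that by (auto simp: forward_null_def T_funpow_scale intro: scale_closed tendsto_N_scale)
  fix b :: real assume "0 < b" "b \<le> min (1/2) (d/2)"
  then have b: "0 \<le> b" "b \<le> 1/2" "b \<le> d/2" by auto
  \<comment> \<open>The signs turn the sum in \<open>T_vec\<close> into the difference in
    \<open>lag_Suc\<close>. The index \<open>Suc n\<close> means that the orbit starts from
    \<open>V 1\<close>.\<close>
  define f where "f = (\<lambda>k n. (-1)^n * lag k (Suc n) b)"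
  have orbit: "(T ^^ k) (vec (f 0)) = vec (f k)" for k
  proof (induction k)
    case (Suc k)
    have "f k n + f k (Suc n) = f (Suc k) n" for n
      by (simp add: f_def lag_Suc algebra_simps)
    with Suc show ?case by (simp add: T_vec)
  qed simp
  have f_le: "\<bar>f k n\<bar> \<le> 1 / sqrt (Suc k) * (b^n / fact n)" for k n
    using lag_bound [OF b(1,2), of k n] by (simp add: f_def abs_mult power_abs)
  have "vec (f 0) \<in> forward_null"
    unfolding forward_null_def orbit
    using vec_bound(1) [OF f_le b(1,3)] vec_tendsto [OF f_le b(1,3), of "\<lambda>k. k"]
      tendsto_inverse_sqrt_shift [of 0]
    by (simp add: orbit)
  then show "vec (\<lambda>n. (-1)^n * (b^Suc n / fact (Suc n))) \<in> forward_null"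
    by (simp add: f_def lag_0)
qed simp

text \<open>\<open>T\<close> need not be injective (the unweighted shift satisfies the growth condition); restricting
  to \<open>W\<^sub>n x\<^sub>n \<longlonglongrightarrow> 0\<close> makes backward orbits unique and the right inverse \<open>S\<close> well defined.\<close>

definition null_backward_orbit :: "(nat \<Rightarrow> nat \<Rightarrow> 'a) \<Rightarrow> bool" where
  "null_backward_orbit z \<longleftrightarrow> (\<forall>k. z k \<in> X \<and> T (z (Suc k)) = z k \<and> (\<lambda>n. W n * z k n) \<longlonglongrightarrow> 0)
      \<and> (\<lambda>k. N (z k)) \<longlonglongrightarrow> 0"

definition backward_null :: "(nat \<Rightarrow> 'a) set" where
  "backward_null = {x. \<exists>z. null_backward_orbit z \<and> z 0 = x}"

lemma backward_null_dense: "dense_in N X backward_null"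
proof (rule dense_of_sign_family [where s = 1])
  show "backward_null \<subseteq> X" by (auto simp: backward_null_def null_backward_orbit_def)
  show "x + y \<in> backward_null" if xy: "x \<in> backward_null" "y \<in> backward_null" for x y
  proof -
    obtain u v where u: "null_backward_orbit u" "u 0 = x" and v: "null_backward_orbit v" "v 0 = y"
      using xy by (auto simp: backward_null_def)
    have "null_backward_orbit (\<lambda>k. u k + v k)"
      using u v unfolding null_backward_orbit_def
      by (auto simp: T_add distrib_left intro: add_closed tendsto_add_zero tendsto_N_add)
    then show ?thesis using u v by (auto simp: backward_null_def)
  qed
  show "(\<lambda>n. c * x n) \<in> backward_null" if x: "x \<in> backward_null" for c x
  proof -
    obtain u where u: "null_backward_orbit u" "u 0 = x"
      using x by (auto simp: backward_null_def)
    have "(\<lambda>n. W n * (c * u k n)) \<longlonglongrightarrow> 0" for k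
      using u tendsto_mult_right_zero [of "\<lambda>n. W n * u k n" sequentially c]
      by (simp add: null_backward_orbit_def mult_ac)
    then have "null_backward_orbit (\<lambda>k n. c * u k n)"
      using u unfolding null_backward_orbit_def
      by (auto simp: T_scale intro: scale_closed tendsto_N_scale)
    then show ?thesis using u by (auto simp: backward_null_def)
  qed
  fix b :: real assume "0 < b" "b \<le> min (1/2) (d/2)"
  then have b: "0 \<le> b" "b \<le> 1/2" "b \<le> d/2" by auto
  \<comment> \<open>No signs here: adding consecutive levels of \<open>wlag (Suc k)\<close> gives
    \<open>wlag k\<close>, so \<open>vec (f (Suc k))\<close> is a preimage of
    \<open>vec (f k)\<close>.\<close>
  define f where "f = (\<lambda>k n. wlag k (Suc n) b)"
  have f_le: "\<bar>f k n\<bar> \<le> 1 / sqrt (Suc (k - 2)) * (b^n / fact n)" for k n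
    using wlag_bound [OF b(1,2), of k n] by (simp add: f_def)
  have "(\<lambda>n. W n * vec (f k) n) \<longlonglongrightarrow> 0" for k
  proof -
    have "f k \<longlonglongrightarrow> 0"
    proof (rule Lim_null_comparison)
      show "eventually (\<lambda>n. norm (f k n) \<le> 1 / sqrt (Suc (k - 2)) * (b^n / fact n)) sequentially"
        using f_le by auto
      have "(\<lambda>n. b^n / fact n) \<longlonglongrightarrow> 0"
        using summable_LIMSEQ_zero [OF summable_exp [of b]] by (simp add: field_simps)
      then show "(\<lambda>n. 1 / sqrt (Suc (k - 2)) * (b^n / fact n)) \<longlonglongrightarrow> 0"
        by (rule tendsto_mult_right_zero)
    qed
    then show ?thesis
      using tendsto_of_real [of "f k" 0 sequentially, where 'a='a] W_nonzero by (simp add: vec_def)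
  qed
  moreover have "T (vec (f (Suc k))) = vec (f k)" for k
    by (simp add: T_vec f_def)
  ultimately have "null_backward_orbit (\<lambda>k. vec (f k))"
    unfolding null_backward_orbit_def
    using vec_bound(1) [OF f_le b(1,3)] vec_tendsto [OF f_le b(1,3) tendsto_inverse_sqrt_shift]
    by simp
  then have "vec (f 0) \<in> backward_null" by (auto simp: backward_null_def)
  then show "vec (\<lambda>n. 1^n * (b^Suc n / fact (Suc n))) \<in> backward_null"
    by (simp add: f_def)
qed simp

text \<open>On the domain where \<open>T\<close> is injective its inverse \<open>S\<close> moves
  each null backward orbit one step along. Tails of such orbits are again such orbits, hence
  \<open>S\<close> preserves \<open>backward_null\<close>.\<close>

lemma kitai: "kitai_criterion N X T"
proof -
  define S where "S = inv_into {x. (\<lambda>n. W n * x n) \<longlonglongrightarrow> 0} T"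
  have inj: "inj_on T {x. (\<lambda>n. W n * x n) \<longlonglongrightarrow> 0}"
    using inj_id_plus_bw_shift [of w] w_nonzero by (auto intro!: inj_onI simp: T_def W_def)
  have S_orbit: "S (z k) = z (Suc k)" if "null_backward_orbit z" for z k
    using that inv_into_f_f [OF inj, of "z (Suc k)"] by (simp add: S_def null_backward_orbit_def)
  have S_funpow: "(S ^^ k) (z 0) = z k" if "null_backward_orbit z" for z k
    by (induction k) (auto simp: S_orbit [OF that])
  have "S x \<in> backward_null \<and> T (S x) = x \<and> (\<lambda>k. N ((S ^^ k) x)) \<longlonglongrightarrow> 0"
    if "x \<in> backward_null" for x
  proof -
    obtain z where z: "null_backward_orbit z" "z 0 = x"
      using \<open>x \<in> backward_null\<close> by (auto simp: backward_null_def)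
    have "null_backward_orbit (\<lambda>k. z (Suc k))"
      using z LIMSEQ_Suc [of "\<lambda>k. N (z k)" 0] by (simp add: null_backward_orbit_def)
    then have "z (Suc 0) \<in> backward_null" by (auto simp: backward_null_def)
    moreover have "T (z (Suc 0)) = z 0" "(\<lambda>k. N (z k)) \<longlonglongrightarrow> 0"
      using z(1) by (simp_all add: null_backward_orbit_def)
    ultimately show ?thesis
      using S_orbit [OF z(1), of 0] S_funpow [OF z(1)] z(2) by simp
  qed
  then show ?thesis
    unfolding kitai_criterion_def
    using forward_null_dense backward_null_dense
    by (intro exI [of _ forward_null] exI [of _ backward_null] exI [of _ S])
       (auto simp: forward_null_def)
qed

end

theorem theorem1p2:
  fixes w :: "nat \<Rightarrow> 'a::real_normed_field"
    and X :: "(nat \<Rightarrow> 'a) set" and N :: "(nat \<Rightarrow> 'a) \<Rightarrow> real"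
  assumes space: "(\<exists>p::real. 1 \<le> p \<and> X = lp_space p \<and> N = lp_norm p)
                  \<or> (X = c0_space \<and> N = c0_norm)"
    and w_nonzero: "\<And>n. n \<ge> 1 \<Longrightarrow> w n \<noteq> 0"
    and w_bounded: "\<exists>M. \<forall>n. norm (w n) \<le> M"
    and growth: "liminf (\<lambda>n. ereal ((fact n * (\<Prod>j=1..n. norm (w j))) powr (1 / real n))) > 0"
  shows "kitai_criterion N X (\<lambda>x. x + bw_shift w x)"
proof -
  interpret seq_quasi_norm X N
    using space lp_quasi_norm c0_quasi_norm by blast
  have pos: "fact n * (\<Prod>j=1..n. norm (w j)) > 0" for n
    using w_nonzero by (auto intro!: mult_pos_pos prod_pos)
  obtain d K where dK: "d > 0" "\<And>n. d^n \<le> K * (fact n * (\<Prod>j=1..n. norm (w j)))"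
    by (rule liminf_root_pos_imp_geometric_bound [OF pos growth]) blast
  interpret weighted_shift_geometric X N w d K
    by unfold_locales (use w_nonzero dK in auto)
  show ?thesis using kitai by (simp add: T_def [abs_def])
qed

end
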